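(* Let $\{A_n\}_{n\ge 0}$ be a sequence of bounded operators on a complex Hilbert space $\mathcal{H}$ with $A_0=I$, and fix one of the four properties "self-adjoint", "positive", "isometric", "unitary". Suppose $\{A_n\}_{n\ge0}$ admits a dilation $B$ with this property on a Hilbert space $\mathcal{K}\supseteq\mathcal{H}$. Then $\{A_n\}_{n\ge0}$ admits a minimal dilation with the same property. Moreover, such a minimal dilation is unique up to unitary equivalence.
   Context: A dilation of $\{A_n\}_{n\ge0}$ (bounded operators on $\mathcal{H}$ with $A_0=I$) is a bounded operator $B$ on a Hilbert space $\mathcal{K}\supseteq\mathcal{H}$ (with $\mathcal H$ a closed subspace) such that $A_n=P_{\mathcal{H}}B^n|_{\mathcal{H}}$ for all $n\ge0$, where $P_{\mathcal{H}}$ is the orthogonal projection of $\mathcal{K}$ onto $\mathcal{H}$ and $B^0=I$. The dilation is called self-adjoint/positive/isometric/unitary if $B$ has that property. A self-adjoint, positive or isometric dilation is minimal if $\mathcal{K}=\overline{\mathrm{span}}\{B^n h: h\in\mathcal{H}, n\in\mathbb{Z}, n\ge0\}$. A unitary dilation is minimal if $\mathcal{K}=\overline{\mathrm{span}}\{B^n h: h\in\mathcal{H}, n\in\mathbb{Z}\}$. Two dilations $B_1$ on $\mathcal{K}_1\supseteq\mathcal{H}$ and $B_2$ on $\mathcal{K}_2\supseteq\mathcal{H}$ are unitarily equivalent if there is a unitary $W:\mathcal{K}_1\to\mathcal{K}_2$ with $WB_1=B_2W$ and $Wh=h$ for all $h\in\mathcal{H}$. *)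

theory Defs
  imports "HOL-Analysis.Analysis"
begin

class complex_vector = real_vector +
  fixes scaleC :: "complex \<Rightarrow> 'a \<Rightarrow> 'a"  (infixr \<open>*\<^sub>C\<close> 75)
  assumes scaleC_add_right: "a *\<^sub>C (x + y) = a *\<^sub>C x + a *\<^sub>C y"
    and scaleC_add_left: "(a + b) *\<^sub>C x = a *\<^sub>C x + b *\<^sub>C x"
    and scaleC_scaleC: "a *\<^sub>C b *\<^sub>C x = (a * b) *\<^sub>C x"
    and scaleC_one: "1 *\<^sub>C x = x"
    and scaleR_scaleC: "r *\<^sub>R x = complex_of_real r *\<^sub>C x"

global_interpretation complex_vector:
    vector_space "scaleC :: complex \<Rightarrow> 'a \<Rightarrow> 'a::complex_vector"
  defines csubspace = complex_vector.subspace
    and cspan = complex_vector.span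
  by unfold_locales
    (simp_all add: scaleC_add_right scaleC_add_left scaleC_scaleC scaleC_one)

text \<open>
  Positive definiteness of \<open>cinner\<close>
  and \<open>norm x = sqrt (Re (cinner x x))\<close> come from \<^class>\<open>real_inner\<close>, because the
  real inner product is required to be the real part of the complex one.
\<close>

class complex_inner = complex_vector + real_inner +
  fixes cinner :: "'a \<Rightarrow> 'a \<Rightarrow> complex"
  assumes cinner_commute: "cinner x y = cnj (cinner y x)"
    and cinner_add_left: "cinner (x + y) z = cinner x z + cinner y z"
    and cinner_scaleC_left: "cinner (a *\<^sub>C x) y = a * cinner x y"
    and inner_eq_Re_cinner: "inner x y = Re (cinner x y)"

class chilbert_space = complex_inner + complete_space

text \<open>
  A Hilbert space is either a whole type of class \<^class>\<open>chilbert_space\<close> or a closed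
  subspace of such a type. An operator on a closed subspace is a total
  function whose values outside the subspace are irrelevant; all notions below are
  relativised to the subspace.
\<close>

definition closed_csubspace :: "'a::chilbert_space set \<Rightarrow> bool" where
  "closed_csubspace M \<longleftrightarrow> csubspace M \<and> closed M"

definition bounded_op :: "'a::chilbert_space set \<Rightarrow> 'b::chilbert_space set \<Rightarrow> ('a \<Rightarrow> 'b) \<Rightarrow> bool" where
  "bounded_op K L T \<longleftrightarrow>
     T ` K \<subseteq> L \<and>
     (\<forall>x\<in>K. \<forall>y\<in>K. T (x + y) = T x + T y) \<and>
     (\<forall>c. \<forall>x\<in>K. T (c *\<^sub>C x) = c *\<^sub>C T x) \<and>
     (\<exists>C. \<forall>x\<in>K. norm (T x) \<le> C * norm x)"

definition isometric_op :: "'a::chilbert_space set \<Rightarrow> 'b::chilbert_space set \<Rightarrow> ('a \<Rightarrow> 'b) \<Rightarrow> bool" where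
  "isometric_op K L T \<longleftrightarrow> bounded_op K L T \<and> (\<forall>x\<in>K. norm (T x) = norm x)"

definition unitary_op :: "'a::chilbert_space set \<Rightarrow> 'b::chilbert_space set \<Rightarrow> ('a \<Rightarrow> 'b) \<Rightarrow> bool" where
  "unitary_op K L T \<longleftrightarrow> isometric_op K L T \<and> T ` K = L"

definition selfadjoint_op :: "'a::chilbert_space set \<Rightarrow> ('a \<Rightarrow> 'a) \<Rightarrow> bool" where
  "selfadjoint_op K T \<longleftrightarrow>
     bounded_op K K T \<and> (\<forall>x\<in>K. \<forall>y\<in>K. cinner (T x) y = cinner x (T y))"

text \<open>Self-adjointness is implied by the condition below, the scalars being complex.\<close>

definition positive_op :: "'a::chilbert_space set \<Rightarrow> ('a \<Rightarrow> 'a) \<Rightarrow> bool" where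
  "positive_op K T \<longleftrightarrow>
     bounded_op K K T \<and> (\<forall>x\<in>K. cinner (T x) x \<in> \<real> \<and> 0 \<le> Re (cinner (T x) x))"

definition orth_proj :: "'a::chilbert_space set \<Rightarrow> 'a \<Rightarrow> 'a" where
  "orth_proj M x = (THE y. y \<in> M \<and> (\<forall>m\<in>M. cinner (x - y) m = 0))"

definition int_power :: "'a set \<Rightarrow> ('a \<Rightarrow> 'a) \<Rightarrow> int \<Rightarrow> 'a \<Rightarrow> 'a" where
  "int_power K B n = (if 0 \<le> n then B ^^ nat n else inv_into K B ^^ nat (- n))"

text \<open>
  The inclusion of \<open>H\<close> into \<open>K\<close> is rendered by an isometric embedding \<open>V\<close> of the type
  \<open>'h\<close> into \<open>K\<close>: a vector \<open>h\<close> of \<open>H\<close>, viewed in \<open>K\<close>, is \<open>V h\<close>, and \<open>H\<close> as a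
  subspace of \<open>K\<close> is \<open>range V\<close>, which is closed since \<open>'h\<close> is complete.
\<close>

definition dilation ::
    "(nat \<Rightarrow> 'h::chilbert_space \<Rightarrow> 'h) \<Rightarrow> 'k::chilbert_space set \<Rightarrow> ('h \<Rightarrow> 'k) \<Rightarrow> ('k \<Rightarrow> 'k) \<Rightarrow> bool" where
  "dilation A K V B \<longleftrightarrow>
     closed_csubspace K \<and> isometric_op UNIV K V \<and> bounded_op K K B \<and>
     (\<forall>n h. V (A n h) = orth_proj (range V) ((B ^^ n) (V h)))"

datatype dilation_kind = Self_adjoint | Positive | Isometric | Unitary

fun has_kind :: "dilation_kind \<Rightarrow> 'k::chilbert_space set \<Rightarrow> ('k \<Rightarrow> 'k) \<Rightarrow> bool" where
  "has_kind Self_adjoint K B \<longleftrightarrow> selfadjoint_op K B"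
| "has_kind Positive K B \<longleftrightarrow> positive_op K B"
| "has_kind Isometric K B \<longleftrightarrow> isometric_op K K B"
| "has_kind Unitary K B \<longleftrightarrow> unitary_op K K B"

definition dilation_of_kind ::
    "dilation_kind \<Rightarrow> (nat \<Rightarrow> 'h::chilbert_space \<Rightarrow> 'h) \<Rightarrow> 'k::chilbert_space set \<Rightarrow> ('h \<Rightarrow> 'k) \<Rightarrow> ('k \<Rightarrow> 'k) \<Rightarrow> bool" where
  "dilation_of_kind p A K V B \<longleftrightarrow> dilation A K V B \<and> has_kind p K B"

definition minimal_dilation ::
    "dilation_kind \<Rightarrow> (nat \<Rightarrow> 'h::chilbert_space \<Rightarrow> 'h) \<Rightarrow> 'k::chilbert_space set \<Rightarrow> ('h \<Rightarrow> 'k) \<Rightarrow> ('k \<Rightarrow> 'k) \<Rightarrow> bool" where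
  "minimal_dilation p A K V B \<longleftrightarrow>
     dilation_of_kind p A K V B \<and>
     K = (if p = Unitary
          then closure (cspan {int_power K B n (V h) | n h. True})
          else closure (cspan {(B ^^ n) (V h) | n h. True}))"

definition unitarily_equivalent ::
    "'k1::chilbert_space set \<Rightarrow> ('h::chilbert_space \<Rightarrow> 'k1) \<Rightarrow> ('k1 \<Rightarrow> 'k1) \<Rightarrow>
     'k2::chilbert_space set \<Rightarrow> ('h \<Rightarrow> 'k2) \<Rightarrow> ('k2 \<Rightarrow> 'k2) \<Rightarrow> bool" where
  "unitarily_equivalent K1 V1 B1 K2 V2 B2 \<longleftrightarrow>
     (\<exists>W. unitary_op K1 K2 W \<and> (\<forall>x\<in>K1. W (B1 x) = B2 (W x)) \<and> (\<forall>h. W (V1 h) = V2 h))"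

end

theory Submission imports Defs begin

text \<open>
  A minimal dilation is obtained by restricting the given one to the closed span of the
  orbit of \<open>H\<close>. For uniqueness, each of the four properties expresses the inner products
  \<open>\<langle>B\<^sup>n h, B\<^sup>m g\<rangle>\<close> through the operators \<open>A\<^sub>n\<close> alone: they equal
  \<open>\<langle>A\<^bsub>n+m\<^esub> h, g\<rangle>\<close> for a self-adjoint \<open>B\<close> and \<open>\<langle>A\<^bsub>n-m\<^esub> h, g\<rangle>\<close>, \<open>m \<le> n\<close>, for
  an isometric one, with exponents in \<open>\<int>\<close> for a unitary one. Hence the correspondence of the two orbits extends to a unitary, whose graph is
  the closed span of the pairs of corresponding orbit vectors in the product Hilbert space.
\<close>

section \<open>The product of two complex Hilbert spaces\<close>

instantiation prod :: (complex_vector, complex_vector) complex_vector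
begin

definition scaleC_prod_def: "c *\<^sub>C z = (c *\<^sub>C fst z, c *\<^sub>C snd z)"

instance
  by standard
    (simp_all add: scaleC_prod_def scaleC_add_right scaleC_add_left scaleC_scaleC scaleC_one
      scaleR_prod_def scaleR_scaleC)

end

instantiation prod :: (complex_inner, complex_inner) complex_inner
begin

text \<open>The real part of this sum is the real inner product that the product type already
  carries, so norm, topology and completeness of the product are the existing ones.\<close>

definition cinner_prod_def: "cinner x y = cinner (fst x) (fst y) + cinner (snd x) (snd y)"

instance
proof
  fix x y z :: "'a \<times> 'b" and a :: complex
  show "cinner x y = cnj (cinner y x)"
    unfolding cinner_prod_def by (metis cinner_commute complex_cnj_add)
  show "cinner (x + y) z = cinner x z + cinner y z"
    by (simp add: cinner_prod_def cinner_add_left)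
  show "cinner (a *\<^sub>C x) y = a * cinner x y"
    by (simp add: cinner_prod_def scaleC_prod_def cinner_scaleC_left algebra_simps)
  show "inner x y = Re (cinner x y)"
    by (simp add: cinner_prod_def inner_prod_def inner_eq_Re_cinner)
qed

end

instance prod :: (chilbert_space, chilbert_space) chilbert_space ..

lemma fst_scaleC [simp]: "fst (c *\<^sub>C z) = c *\<^sub>C fst z"
  and snd_scaleC [simp]: "snd (c *\<^sub>C z) = c *\<^sub>C snd z"
  by (simp_all add: scaleC_prod_def)

section \<open>Elementary properties of the complex inner product\<close>

lemma cinner_add_right: "cinner x (y + z) = cinner x y + cinner x z"
  by (metis cinner_add_left cinner_commute complex_cnj_add)

lemma cinner_scaleC_right: "cinner x (a *\<^sub>C y) = cnj a * cinner x y"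
  by (metis cinner_commute cinner_scaleC_left complex_cnj_cnj complex_cnj_mult)

lemma cinner_zero_left [simp]: "cinner 0 x = 0"
  by (metis add_cancel_right_right cinner_add_left)

lemma cinner_zero_right [simp]: "cinner x 0 = 0"
  by (metis cinner_commute cinner_zero_left complex_cnj_zero)

lemma cinner_minus_left: "cinner (- x) y = - cinner x y"
  by (metis add.right_inverse add_eq_0_iff cinner_add_left cinner_zero_left)

lemma cinner_diff_left: "cinner (x - y) z = cinner x z - cinner y z"
  by (metis cinner_add_left cinner_minus_left diff_conv_add_uminus)

lemma cinner_self: "cinner x x = complex_of_real ((norm x)\<^sup>2)"
proof -
  have "Im (cinner x x) = 0"
    by (metis cinner_commute cnj.simps(2) neg_equal_zero)
  moreover have "Re (cinner x x) = (norm x)\<^sup>2"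
    by (simp add: inner_eq_Re_cinner [symmetric] power2_norm_eq_inner)
  ultimately show ?thesis
    by (simp add: complex_eq_iff)
qed

lemma cinner_self_eq_zero [simp]: "cinner x x = 0 \<longleftrightarrow> x = 0"
  by (simp add: cinner_self)

text \<open>The norm comes with real homogeneity only; the complex version is recovered by comparing
  squares through \<open>cinner_self\<close>.\<close>

lemma norm_scaleC: "norm (c *\<^sub>C x) = cmod c * norm (x :: 'a::complex_inner)"
proof -
  have "complex_of_real ((norm (c *\<^sub>C x))\<^sup>2) = complex_of_real ((cmod c * norm x)\<^sup>2)"
    unfolding cinner_self [symmetric]
    by (simp add: cinner_scaleC_left cinner_scaleC_right power_mult_distrib
        complex_norm_square del: of_real_power)
       (simp add: cinner_self)
  then have "(norm (c *\<^sub>C x))\<^sup>2 = (cmod c * norm x)\<^sup>2"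
    using of_real_eq_iff by blast
  then show ?thesis
    by (simp add: power2_eq_iff_nonneg)
qed

lemma bounded_linear_scaleC: "bounded_linear (\<lambda>x :: 'a::complex_inner. c *\<^sub>C x)"
  by (rule bounded_linear_intro [where K = "cmod c"])
    (simp_all add: scaleC_add_right scaleR_scaleC scaleC_scaleC norm_scaleC mult.commute)

section \<open>Closed complex subspaces and closed spans\<close>

lemma csubspace_imp_subspace: "csubspace M \<Longrightarrow> subspace M"
  by (simp add: subspace_def complex_vector.subspace_def scaleR_scaleC)

lemma csubspace_closure:
  fixes M :: "'a::complex_inner set"
  assumes "csubspace M"
  shows "csubspace (closure M)"
proof (rule complex_vector.subspaceI)
  show "0 \<in> closure M"
    using assms closure_subset complex_vector.subspace_0 by blast
  show "x + y \<in> closure M" if "x \<in> closure M" "y \<in> closure M" for x y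
    using that assms unfolding closure_sequential
    by (metis (mono_tags) complex_vector.subspace_add tendsto_add)
  show "c *\<^sub>C x \<in> closure M" if "x \<in> closure M" for c x
  proof -
    have "(*\<^sub>C) c ` closure M \<subseteq> closure ((*\<^sub>C) c ` M)"
      by (simp add: closure_bounded_linear_image_subset bounded_linear_scaleC)
    also have "\<dots> \<subseteq> closure M"
      using assms by (intro closure_mono) (auto intro: complex_vector.subspace_scale)
    finally show ?thesis
      using that by blast
  qed
qed

lemma closed_csubspace_closure_cspan: "closed_csubspace (closure (cspan S))"
  by (simp add: closed_csubspace_def csubspace_closure complex_vector.subspace_span)

text \<open>This serves as the induction principle for closed spans: a property holds throughout
  once it holds on the generators and defines a closed subspace.\<close>

lemma closure_cspan_minimal:
  assumes "closed_csubspace M" "S \<subseteq> M"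
  shows "closure (cspan S) \<subseteq> M"
  using assms complex_vector.span_minimal closure_minimal
  unfolding closed_csubspace_def by metis

lemma closure_cspan_superset: "S \<subseteq> closure (cspan S)"
  using complex_vector.span_superset closure_subset by (metis order_trans)

section \<open>Orthogonal projection onto a closed subspace\<close>

lemma projection_exists:
  fixes x :: "'a::chilbert_space"
  assumes "closed_csubspace M"
  obtains y where "y \<in> M" "\<And>m. m \<in> M \<Longrightarrow> cinner (x - y) m = 0"
proof -
  have M: "csubspace M" "closed M" "subspace M" "0 \<in> M"
    using assms by (auto simp: closed_csubspace_def csubspace_imp_subspace complex_vector.subspace_0)
  define d where "d = infdist x M"
  define e where "e n = inverse (real (Suc n))" for n
  define S where "S n = M \<inter> cball x (d + e n)" for n
  have d: "d \<le> dist x y" if "y \<in> M" for y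
    using that by (simp add: d_def infdist_le)
  have epos: "e n > 0" for n
    by (simp add: e_def)
  have d0: "d \<ge> 0"
    by (simp add: d_def infdist_nonneg)
  \<comment> \<open>The sets \<open>S n\<close> of almost nearest points are nested, closed and
    nonempty, with diameters tending to 0; completeness yields a common point, which is a nearest
    point of \<open>M\<close>.\<close>
  obtain y where y: "\<And>n. y \<in> S n"
  proof (rule decreasing_closed_nest[of S])
    show "closed (S n)" for n
      using M by (auto simp: S_def)
    show "S n \<noteq> {}" for n
    proof -
      have "infdist x M < d + e n"
        using epos[of n] by (simp add: d_def)
      then obtain a where "a \<in> M" "dist x a < d + e n"
        using \<open>0 \<in> M\<close> by (auto simp: infdist_def cINF_less_iff split: if_splits)
      then show ?thesis
        by (auto simp: S_def intro!: exI[of _ a])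
    qed
    show "S n \<subseteq> S m" if "m \<le> n" for m n
    proof -
      have "e n \<le> e m"
        using that by (simp add: e_def)
      then show ?thesis
        by (auto simp: S_def)
    qed
    show "\<exists>n. \<forall>y\<in>S n. \<forall>z\<in>S n. dist y z < \<epsilon>" if "\<epsilon> > 0" for \<epsilon>
    proof -
      \<comment> \<open>The quantity \<open>4 * ((d + e n)\<^sup>2 - d\<^sup>2)\<close> bounds the
        squared diameter of \<open>S n\<close>: in the parallelogram law two terms are at most
        \<open>2 * (d + e n)\<^sup>2\<close> each, and the midpoint lies in \<open>M\<close>, so its
        distance from \<open>x\<close> is at least \<open>d\<close>.\<close>
      have "(\<lambda>n. 4 * ((d + e n)\<^sup>2 - d\<^sup>2)) \<longlonglongrightarrow> 4 * ((d + 0)\<^sup>2 - d\<^sup>2)"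
        unfolding e_def by (intro tendsto_intros LIMSEQ_inverse_real_of_nat)
      then have "\<forall>\<^sub>F n in sequentially. 4 * ((d + e n)\<^sup>2 - d\<^sup>2) < \<epsilon>\<^sup>2"
        using that by (intro order_tendstoD) auto
      then obtain n where n: "4 * ((d + e n)\<^sup>2 - d\<^sup>2) < \<epsilon>\<^sup>2"
        using eventually_happens trivial_limit_sequentially by blast
      have "dist y z < \<epsilon>" if yz: "y \<in> S n" "z \<in> S n" for y z
      proof -
        have "(1/2) *\<^sub>R (y + z) \<in> M"
          using yz M by (auto simp: S_def intro: subspace_scale subspace_add)
        then have "d\<^sup>2 \<le> (norm (x - (1/2) *\<^sub>R (y + z)))\<^sup>2"
          using d d0 by (intro power_mono) (auto simp: dist_norm)
        moreover have "(norm (x - y))\<^sup>2 \<le> (d + e n)\<^sup>2" "(norm (x - z))\<^sup>2 \<le> (d + e n)\<^sup>2"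
          using yz by (auto simp: S_def dist_norm intro!: power_mono)
        moreover have "(norm (y - z))\<^sup>2 = 2 * (norm (x - y))\<^sup>2 + 2 * (norm (x - z))\<^sup>2
            - 4 * (norm (x - (1/2) *\<^sub>R (y + z)))\<^sup>2"
          by (simp add: power2_norm_eq_inner inner_diff inner_add inner_commute algebra_simps)
        ultimately have "(norm (y - z))\<^sup>2 < \<epsilon>\<^sup>2"
          using n by argo
        then show ?thesis
          using \<open>\<epsilon> > 0\<close> by (simp add: dist_norm power2_less_imp_less)
      qed
      then show ?thesis by blast
    qed
  qed (use that in blast)
  have yM: "y \<in> M"
    using y by (auto simp: S_def)
  have "norm (x - y) \<le> d"
  proof (rule LIMSEQ_le_const)
    show "(\<lambda>n. d + e n) \<longlonglongrightarrow> d"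
      unfolding e_def using tendsto_add[OF tendsto_const LIMSEQ_inverse_real_of_nat, of d] by simp
    show "\<exists>N. \<forall>n\<ge>N. norm (x - y) \<le> d + e n"
      using y by (auto simp: S_def dist_norm)
  qed
  then have min: "norm (x - y) \<le> norm (x - z)" if "z \<in> M" for z
    using d[OF that] by (simp add: dist_norm)
  have orth: "inner (x - y) m = 0" if "m \<in> M" for m
  proof (cases "m = 0")
    case False
    \<comment> \<open>This \<open>t\<close> minimises the quadratic
      \<open>norm (x - (y + t *\<^sub>R m))\<^sup>2\<close>. Since \<open>y\<close> is already
      nearest, the decrease \<open>(inner (x - y) m)\<^sup>2 / (norm m)\<^sup>2\<close> has to
      vanish.\<close>
    define t where "t = inner (x - y) m / (norm m)\<^sup>2"
    have nm: "(norm m)\<^sup>2 > 0"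
      using False by simp
    have "y + t *\<^sub>R m \<in> M"
      using M yM that by (simp add: subspace_add subspace_scale)
    then have "(norm (x - y))\<^sup>2 \<le> (norm (x - (y + t *\<^sub>R m)))\<^sup>2"
      by (intro power_mono min) auto
    also have "\<dots> = (norm (x - y))\<^sup>2 - 2 * t * inner (x - y) m + t\<^sup>2 * (norm m)\<^sup>2"
      unfolding power2_norm_eq_inner
      by (simp add: inner_diff inner_add inner_commute algebra_simps power2_eq_square)
    also have "\<dots> = (norm (x - y))\<^sup>2 - (inner (x - y) m)\<^sup>2 / (norm m)\<^sup>2"
      using nm by (simp add: t_def field_simps power2_eq_square)
    finally have "(inner (x - y) m)\<^sup>2 / (norm m)\<^sup>2 \<le> 0"
      by simp
    then show ?thesis
      using nm by (simp add: divide_le_0_iff)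
  qed simp
  have "cinner (x - y) m = 0" if "m \<in> M" for m
  proof -
    have "Re (cinner (x - y) m) = 0"
      using orth[OF that] by (simp add: inner_eq_Re_cinner)
    \<comment> \<open>Real orthogonality controls the real part only; testing against
      \<open>\<i> *\<^sub>C m\<close>, which also lies in \<open>M\<close>, gives the imaginary
      part.\<close>
    moreover have "\<i> *\<^sub>C m \<in> M"
      using M that by (simp add: complex_vector.subspace_scale)
    then have "Re (cinner (x - y) (\<i> *\<^sub>C m)) = 0"
      using orth by (simp add: inner_eq_Re_cinner)
    ultimately show ?thesis
      by (simp add: cinner_scaleC_right complex_eq_iff)
  qed
  with yM that show thesis by blast
qed

text \<open>\<open>orth_proj\<close> is a definite description, so its defining property becomes
  available only after existence and uniqueness are established. Uniqueness holds because the
  difference of two candidates lies in \<open>M\<close> and is orthogonal to itself.\<close>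

lemma cinner_orth_proj:
  fixes x :: "'a::chilbert_space"
  assumes "closed_csubspace M" and m: "m \<in> M"
  shows "cinner (orth_proj M x) m = cinner x m"
proof -
  have M: "csubspace M"
    using assms by (simp add: closed_csubspace_def)
  obtain y where y: "y \<in> M" "\<And>m. m \<in> M \<Longrightarrow> cinner (x - y) m = 0"
    using projection_exists[OF assms(1), of x] by blast
  have "\<exists>!y. y \<in> M \<and> (\<forall>m\<in>M. cinner (x - y) m = 0)"
  proof (rule ex1I[of _ y])
    fix z assume z: "z \<in> M \<and> (\<forall>m\<in>M. cinner (x - z) m = 0)"
    then have "y - z \<in> M"
      using y M complex_vector.subspace_diff by blast
    then have "cinner (x - z) (y - z) - cinner (x - y) (y - z) = 0"
      using y z by simp
    then have "cinner (y - z) (y - z) = 0"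
      by (simp add: cinner_diff_left)
    then show "z = y" by simp
  qed (use y in auto)
  from theI'[OF this] have "cinner (x - orth_proj M x) m = 0"
    using m by (simp add: orth_proj_def)
  then show ?thesis
    by (simp add: cinner_diff_left)
qed

section \<open>Closed subspaces of the product as graphs of isometries\<close>

lemma cinner_span_transfer:
  assumes gram: "\<And>i j. cinner (e i) (e j) = cinner (f i) (f j)"
    and z: "z \<in> cspan (range (\<lambda>i. (e i, f i)))" and w: "w \<in> cspan (range (\<lambda>i. (e i, f i)))"
  shows "cinner (fst z) (fst w) = cinner (snd z) (snd w)"
proof -
  \<comment> \<open>Both sides are sesquilinear, so the Gram identity extends in one argument at a
    time: first \<open>z\<close> runs through the span against a fixed generator, then
    \<open>w\<close> does.\<close>
  have "cinner (fst z) (e j) = cinner (snd z) (f j)" for j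
    using z
    by (induction rule: complex_vector.span_induct_alt)
      (auto simp: cinner_add_left cinner_scaleC_left gram)
  with w show ?thesis
    by (induction rule: complex_vector.span_induct_alt)
      (auto simp: cinner_add_right cinner_scaleC_right)
qed

text \<open>A projection of a closed subspace need not be closed. Here
  \<open>norm z \<le> 2 * norm (fst z)\<close> on \<open>Q\<close>, so \<open>fst\<close> is bounded
  below there and carries the complete set \<open>Q\<close> to a complete set.\<close>

lemma closed_csubspace_fst_image:
  fixes Q :: "('a::chilbert_space \<times> 'b::chilbert_space) set"
  assumes Q: "closed_csubspace Q" and le: "\<And>z. z \<in> Q \<Longrightarrow> norm (snd z) \<le> norm (fst z)"
  shows "closed_csubspace (fst ` Q)"
  unfolding closed_csubspace_def
proof
  have c: "csubspace Q" "closed Q"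
    using Q by (auto simp: closed_csubspace_def)
  show "csubspace (fst ` Q)"
  proof (rule complex_vector.subspaceI; safe?)
    show "0 \<in> fst ` Q"
      using c complex_vector.subspace_0 fst_zero by (metis imageI)
    show "fst z + fst w \<in> fst ` Q" if "z \<in> Q" "w \<in> Q" for z w
      using c that by (metis complex_vector.subspace_add fst_add imageI)
    show "a *\<^sub>C fst z \<in> fst ` Q" if "z \<in> Q" for a z
      using c that by (metis complex_vector.subspace_scale fst_scaleC imageI)
  qed
  have "complete (fst ` Q)"
  proof (rule complete_isometric_image[where e = "1/2"])
    show "\<forall>z\<in>Q. 1/2 * norm z \<le> norm (fst z)"
    proof
      fix z assume "z \<in> Q"
      have "norm z \<le> norm (fst z) + norm (snd z)"
        using norm_Pair_le[of "fst z" "snd z"] by simp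
      with le[OF \<open>z \<in> Q\<close>] show "1/2 * norm z \<le> norm (fst z)"
        by linarith
    qed
  qed (use c in \<open>auto simp: csubspace_imp_subspace bounded_linear_fst complete_eq_closed\<close>)
  then show "closed (fst ` Q)"
    by (simp add: complete_eq_closed)
qed

lemma closed_csubspace_fst_vimage:
  fixes K :: "'a::chilbert_space set"
  assumes "closed_csubspace K"
  shows "closed_csubspace {z :: 'a \<times> 'b::chilbert_space. fst z \<in> K}"
proof -
  have "closed (fst -` K :: ('a \<times> 'b) set)"
    using assms by (simp add: closed_csubspace_def closed_vimage_fst)
  with assms show ?thesis
    by (auto simp: closed_csubspace_def complex_vector.subspace_def vimage_def)
qed

text \<open>Both inclusions are minimality of a closed span: one uses the closed preimage under
  \<open>fst\<close>, the other the closedness of the image, which the norm bound supplies.\<close>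

lemma fst_image_closure_cspan:
  fixes S :: "('a::chilbert_space \<times> 'b::chilbert_space) set"
  assumes "\<And>z. z \<in> closure (cspan S) \<Longrightarrow> norm (snd z) \<le> norm (fst z)"
  shows "fst ` closure (cspan S) = closure (cspan (fst ` S))"
proof
  have "closure (cspan S) \<subseteq> {z. fst z \<in> closure (cspan (fst ` S))}"
    by (intro closure_cspan_minimal closed_csubspace_fst_vimage closed_csubspace_closure_cspan)
      (use closure_cspan_superset[of "fst ` S"] in auto)
  then show "fst ` closure (cspan S) \<subseteq> closure (cspan (fst ` S))"
    by blast
  show "closure (cspan (fst ` S)) \<subseteq> fst ` closure (cspan S)"
    by (intro closure_cspan_minimal closed_csubspace_fst_image closed_csubspace_closure_cspan assms)
      (use closure_cspan_superset[of S] in auto)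
qed

lemma cspan_swap: "z \<in> cspan S \<Longrightarrow> prod.swap z \<in> cspan (prod.swap ` S)"
proof (induction rule: complex_vector.span_induct_alt)
  case base
  then show ?case
    using complex_vector.span_zero[of "prod.swap ` S"] by (simp add: zero_prod_def)
next
  case (step c x y)
  have "prod.swap (c *\<^sub>C x + y) = c *\<^sub>C prod.swap x + prod.swap y"
    by (simp add: prod_eq_iff)
  with step show ?case
    by (auto intro: complex_vector.span_add complex_vector.span_base complex_vector.span_scale)
qed

lemma closure_cspan_swap:
  "z \<in> closure (cspan S) \<Longrightarrow> prod.swap z \<in> closure (cspan (prod.swap ` S))"
proof -
  assume z: "z \<in> closure (cspan S)"
  have "prod.swap ` closure (cspan S) \<subseteq> closure (prod.swap ` cspan S)"
    by (intro continuous_image_closure_subset[of UNIV])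
      (auto simp: prod.swap_def intro!: continuous_intros)
  also have "\<dots> \<subseteq> closure (cspan (prod.swap ` S))"
    by (intro closure_mono) (use cspan_swap in blast)
  finally show ?thesis
    using z by blast
qed

lemma snd_image_closure_cspan:
  fixes S :: "('a::chilbert_space \<times> 'b::chilbert_space) set"
  assumes le: "\<And>z. z \<in> closure (cspan S) \<Longrightarrow> norm (fst z) \<le> norm (snd z)"
  shows "snd ` closure (cspan S) = closure (cspan (snd ` S))"
proof -
  \<comment> \<open>The swap is a continuous linear involution, so the one-sided statement
    \<open>closure_cspan_swap\<close>, applied to \<open>S\<close> and to its swapped copy, gives
    equality. The claim for \<open>snd\<close> then reduces to the one for
    \<open>fst\<close>.\<close>
  have swap: "closure (cspan (prod.swap ` S)) = prod.swap ` closure (cspan S)"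
    using closure_cspan_swap[of _ S] closure_cspan_swap[of _ "prod.swap ` S"]
    by (force simp: image_image)
  have "fst ` closure (cspan (prod.swap ` S)) = closure (cspan (fst ` prod.swap ` S))"
    by (intro fst_image_closure_cspan) (use le in \<open>force simp: swap\<close>)
  then show ?thesis
    by (simp add: swap image_image)
qed

section \<open>Bounded operators on closed spans\<close>

lemma bounded_op_continuous_on:
  assumes "bounded_op K L T" "csubspace K"
  shows "continuous_on K T"
proof -
  obtain C where C: "\<And>x. x \<in> K \<Longrightarrow> norm (T x) \<le> C * norm x"
    using assms unfolding bounded_op_def by blast
  have diff: "T (x - y) = T x - T y" if "x \<in> K" "y \<in> K" for x y
  proof -
    have "x - y \<in> K"
      using assms that complex_vector.subspace_diff by blast
    then have "T (x - y + y) = T (x - y) + T y"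
      using assms(1) that unfolding bounded_op_def by blast
    then show ?thesis by simp
  qed
  \<comment> \<open>The bound \<open>C\<close> may be negative when \<open>K\<close> is trivial,
    whereas a Lipschitz constant must be nonnegative.\<close>
  have "\<bar>C\<bar>-lipschitz_on K T"
  proof (rule lipschitz_onI)
    fix x y assume xy: "x \<in> K" "y \<in> K"
    then have "x - y \<in> K"
      using assms complex_vector.subspace_diff by blast
    from C[OF this] have "norm (T x - T y) \<le> C * norm (x - y)"
      using diff[OF xy] by simp
    also have "\<dots> \<le> \<bar>C\<bar> * norm (x - y)"
      by (intro mult_right_mono) auto
    finally show "dist (T x) (T y) \<le> \<bar>C\<bar> * dist x y"
      by (simp add: dist_norm)
  qed simp
  then show ?thesis
    by (rule lipschitz_on_continuous_on)
qed

text \<open>Linearity takes the inclusion from the generators to the span, and continuity takes it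
  to the closure. It yields the invariance of graphs and of orbit spans.\<close>

lemma bounded_op_maps_closure_cspan:
  assumes T: "bounded_op K L T" and K: "closed_csubspace K" and S: "S \<subseteq> K"
    and gen: "\<And>x. x \<in> S \<Longrightarrow> T x \<in> M" and M: "closed_csubspace M"
  shows "T ` closure (cspan S) \<subseteq> M"
proof -
  have sub: "closure (cspan S) \<subseteq> K"
    using K S by (rule closure_cspan_minimal)
  have cont: "continuous_on (closure (cspan S)) T"
    using bounded_op_continuous_on[OF T] K sub continuous_on_subset
    unfolding closed_csubspace_def by blast
  \<comment> \<open>\<open>T\<close> is known to be linear on \<open>K\<close> only, so membership
    in \<open>K\<close> is carried through the induction.\<close>
  have "x \<in> K \<and> T x \<in> M" if "x \<in> cspan S" for x
    using that
  proof (induction rule: complex_vector.span_induct_alt)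
    case base
    have K0: "0 \<in> K"
      using K by (simp add: closed_csubspace_def complex_vector.subspace_0)
    then have "T (0 + 0) = T 0 + T 0"
      using T unfolding bounded_op_def by blast
    then have "T 0 = 0"
      by simp
    then show ?case
      using K0 M by (simp add: closed_csubspace_def complex_vector.subspace_0)
  next
    case (step c x y)
    have cx: "c *\<^sub>C x \<in> K"
      using K S step by (auto simp: closed_csubspace_def complex_vector.subspace_scale)
    moreover have "y \<in> K" "x \<in> K"
      using step S by auto
    ultimately have "T (c *\<^sub>C x + y) = c *\<^sub>C T x + T y"
      using T unfolding bounded_op_def by auto
    then show ?case
      using K M step gen cx
      by (auto simp: closed_csubspace_def complex_vector.subspace_add complex_vector.subspace_scale)
  qed
  then have "T ` cspan S \<subseteq> M" by blast
  then show ?thesis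
    using image_closure_subset[OF cont] M by (simp add: closed_csubspace_def)
qed

lemma bounded_op_map_prod:
  fixes S :: "'a::chilbert_space \<Rightarrow> 'a" and T :: "'b::chilbert_space \<Rightarrow> 'b"
  assumes "bounded_op K K S" "bounded_op L L T"
  shows "bounded_op (K \<times> L) (K \<times> L) (map_prod S T)"
proof -
  obtain C where C: "\<And>x. x \<in> K \<Longrightarrow> norm (S x) \<le> C * norm x"
    using assms(1) unfolding bounded_op_def by blast
  obtain D where D: "\<And>x. x \<in> L \<Longrightarrow> norm (T x) \<le> D * norm x"
    using assms(2) unfolding bounded_op_def by blast
  have "norm (map_prod S T z) \<le> (\<bar>C\<bar> + \<bar>D\<bar>) * norm z" if "z \<in> K \<times> L" for z
  proof -
    obtain x y where z: "z = (x, y)" "x \<in> K" "y \<in> L"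
      using \<open>z \<in> K \<times> L\<close> by blast
    have "norm x \<le> norm z" "norm y \<le> norm z"
      by (simp_all add: z norm_Pair real_le_rsqrt)
    then have "\<bar>C\<bar> * norm x \<le> \<bar>C\<bar> * norm z" "\<bar>D\<bar> * norm y \<le> \<bar>D\<bar> * norm z"
      by (simp_all add: mult_left_mono)
    moreover have "C * norm x \<le> \<bar>C\<bar> * norm x" "D * norm y \<le> \<bar>D\<bar> * norm y"
      by (simp_all add: mult_right_mono)
    moreover have "norm (map_prod S T z) \<le> norm (S x) + norm (T y)"
      using norm_Pair_le[of "S x" "T y"] by (simp add: z)
    ultimately show ?thesis
      using C[OF z(2)] D[OF z(3)] by (simp add: distrib_right)
  qed
  then have "\<exists>C. \<forall>z\<in>K \<times> L. norm (map_prod S T z) \<le> C * norm z"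
    by blast
  moreover have "map_prod S T ` (K \<times> L) \<subseteq> K \<times> L"
    using assms by (auto simp: bounded_op_def)
  moreover have "map_prod S T (z + w) = map_prod S T z + map_prod S T w"
    if "z \<in> K \<times> L" "w \<in> K \<times> L" for z w
    using assms that unfolding bounded_op_def by (simp add: prod_eq_iff mem_Times_iff)
  moreover have "map_prod S T (c *\<^sub>C z) = c *\<^sub>C map_prod S T z" if "z \<in> K \<times> L" for c z
    using assms that unfolding bounded_op_def by (simp add: prod_eq_iff mem_Times_iff)
  ultimately show ?thesis
    unfolding bounded_op_def by blast
qed

lemma closed_csubspace_Times:
  "closed_csubspace K \<Longrightarrow> closed_csubspace L \<Longrightarrow> closed_csubspace (K \<times> L)"
  by (auto simp: closed_csubspace_def complex_vector.subspace_def closed_Times mem_Times_iff)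

text \<open>Equal Gram families make \<open>Q\<close> the graph of an isometry: its elements have
  components of equal norm, and its two projections fill \<open>K\<close> and \<open>L\<close>. The
  relation \<open>W S = T W\<close> says that this graph is invariant under the product operator;
  \<open>\<sigma>\<close> is the common action of \<open>S\<close> and \<open>T\<close> on the index
  set.\<close>

lemma unitary_intertwiner:
  fixes e :: "'i \<Rightarrow> 'a::chilbert_space" and f :: "'i \<Rightarrow> 'b::chilbert_space"
  assumes gram: "\<And>i j. cinner (e i) (e j) = cinner (f i) (f j)"
    and K: "K = closure (cspan (range e))" and L: "L = closure (cspan (range f))"
    and S: "bounded_op K K S" "\<And>i. S (e i) = e (\<sigma> i)"
    and T: "bounded_op L L T" "\<And>i. T (f i) = f (\<sigma> i)"
  obtains W where "unitary_op K L W" "\<And>x. x \<in> K \<Longrightarrow> W (S x) = T (W x)" "\<And>i. W (e i) = f i"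
proof -
  define G where "G = range (\<lambda>i. (e i, f i))"
  define Q where "Q = closure (cspan G)"
  have Q: "closed_csubspace Q"
    unfolding Q_def by (rule closed_csubspace_closure_cspan)
  then have csQ: "csubspace Q"
    by (simp add: closed_csubspace_def)
  \<comment> \<open>On the span this is the Gram transfer with both arguments equal; equality of the
    two norms is a closed condition, so it persists in the closure.\<close>
  have eq: "norm (fst z) = norm (snd z)" if "z \<in> Q" for z
  proof -
    have "cspan G \<subseteq> {z. norm (fst z) = norm (snd z)}"
    proof clarify
      fix a b assume ab: "(a, b) \<in> cspan G"
      have "cinner (fst (a, b)) (fst (a, b)) = cinner (snd (a, b)) (snd (a, b))"
        by (rule cinner_span_transfer[OF gram]) (use ab in \<open>auto simp: G_def\<close>)
      then have "(norm a)\<^sup>2 = (norm b)\<^sup>2"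
        unfolding cinner_self by (metis fst_conv snd_conv of_real_eq_iff)
      then show "norm (fst (a, b)) = norm (snd (a, b))"
        by simp
    qed
    then have "Q \<subseteq> {z. norm (fst z) = norm (snd z)}"
      unfolding Q_def by (intro closure_minimal closed_Collect_eq) (auto intro!: continuous_intros)
    with that show ?thesis by blast
  qed
  have fstQ: "fst ` Q = K"
    unfolding Q_def K
    by (subst fst_image_closure_cspan) (auto simp: eq[unfolded Q_def] G_def image_image)
  have sndQ: "snd ` Q = L"
    unfolding Q_def L
    by (subst snd_image_closure_cspan) (auto simp: eq[unfolded Q_def] G_def image_image)
  \<comment> \<open>The difference of two elements with the same first component has first component
    0, hence by \<open>eq\<close> also second component 0. So \<open>Q\<close> is the graph of a
    function, which \<open>W\<close> names.\<close>
  have inj: "inj_on fst Q"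
  proof (rule inj_onI)
    fix z w assume zw: "z \<in> Q" "w \<in> Q" "fst z = fst w"
    then have "z - w \<in> Q"
      using csQ complex_vector.subspace_diff by blast
    from eq[OF this] zw show "z = w"
      by (simp add: prod_eq_iff)
  qed
  define W where "W x = snd (inv_into Q fst x)" for x
  have W: "W (fst z) = snd z" if "z \<in> Q" for z
    using that inj by (simp add: W_def)
  have cK: "closed_csubspace K" and cL: "closed_csubspace L"
    unfolding K L by (rule closed_csubspace_closure_cspan)+
  have GQ: "(e i, f i) \<in> Q" for i
    using closure_cspan_superset[of G] by (auto simp: Q_def G_def)
  have GKL: "G \<subseteq> K \<times> L"
    using closure_cspan_superset[of "range e"] closure_cspan_superset[of "range f"]
    by (auto simp: G_def K L)
  have "bounded_op K L W"
    unfolding bounded_op_def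
  proof (intro conjI exI[of _ 1] ballI allI)
    show "W ` K \<subseteq> L"
      using W by (auto simp flip: fstQ sndQ)
    show "norm (W x) \<le> 1 * norm x" if "x \<in> K" for x
      using that W eq by (auto simp flip: fstQ)
    show "W (x + y) = W x + W y" if "x \<in> K" "y \<in> K" for x y
    proof -
      have "x \<in> fst ` Q" "y \<in> fst ` Q"
        using that by (simp_all add: fstQ)
      then obtain z w where z: "z \<in> Q" "w \<in> Q" "x = fst z" "y = fst w"
        by blast
      then show ?thesis
        using W[of "z + w"] W csQ by (simp add: complex_vector.subspace_add)
    qed
    show "W (c *\<^sub>C x) = c *\<^sub>C W x" if "x \<in> K" for c x
    proof -
      have "x \<in> fst ` Q"
        using that by (simp add: fstQ)
      then obtain z where z: "z \<in> Q" "x = fst z"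
        by blast
      then show ?thesis
        using W[of "c *\<^sub>C z"] W csQ by (simp add: complex_vector.subspace_scale)
    qed
  qed
  moreover have "norm (W x) = norm x" if "x \<in> K" for x
    using that W eq by (auto simp flip: fstQ)
  moreover have "W ` K = L"
    unfolding fstQ[symmetric] sndQ[symmetric] image_image using W by (rule image_cong[OF refl])
  ultimately have "unitary_op K L W"
    by (simp add: unitary_op_def isometric_op_def)
  moreover have "W (S x) = T (W x)" if "x \<in> K" for x
  proof -
    have "x \<in> fst ` Q"
      using that by (simp add: fstQ)
    then obtain z where z: "z \<in> Q" "x = fst z"
      by blast
    \<comment> \<open>On generators, \<open>map_prod S T\<close> sends the pair with index
      \<open>i\<close> to the pair with index \<open>\<sigma> i\<close>, so \<open>G\<close> is
      mapped into \<open>Q\<close>; the closed span follows.\<close>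
    have "map_prod S T ` Q \<subseteq> Q"
      unfolding Q_def
    proof (rule bounded_op_maps_closure_cspan)
      show "bounded_op (K \<times> L) (K \<times> L) (map_prod S T)"
        using S T by (intro bounded_op_map_prod)
      show "closed_csubspace (K \<times> L)"
        using cK cL by (rule closed_csubspace_Times)
      show "map_prod S T x \<in> closure (cspan G)" if "x \<in> G" for x
      proof -
        obtain i where "x = (e i, f i)"
          using \<open>x \<in> G\<close> by (auto simp: G_def)
        then show ?thesis
          using GQ[of "\<sigma> i"] by (simp add: Q_def S T)
      qed
      show "G \<subseteq> K \<times> L"
        by (rule GKL)
      show "closed_csubspace (closure (cspan G))"
        by (rule closed_csubspace_closure_cspan)
    qed
    then have "map_prod S T z \<in> Q"
      using z by blast
    from W[OF this] W[OF z(1)] z show ?thesis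
      by simp
  qed
  moreover have "W (e i) = f i" for i
    using W[OF GQ] by simp
  ultimately show thesis
    using that by blast
qed

section \<open>Isometric, positive and self-adjoint operators\<close>

lemma isometric_op_cinner:
  assumes T: "isometric_op K L T" and K: "csubspace K" and xy: "x \<in> K" "y \<in> K"
  shows "cinner (T x) (T y) = cinner x y"
proof -
  have lin: "\<And>u v. u \<in> K \<Longrightarrow> v \<in> K \<Longrightarrow> T (u + v) = T u + T v"
    "\<And>c u. u \<in> K \<Longrightarrow> T (c *\<^sub>C u) = c *\<^sub>C T u"
    and norm: "\<And>u. u \<in> K \<Longrightarrow> norm (T u) = norm u"
    using T by (auto simp: isometric_op_def bounded_op_def)
  \<comment> \<open>Polarisation expresses the real inner product by norms. Replacing
    \<open>y\<close> by \<open>\<i> *\<^sub>C y\<close> then recovers the imaginary part of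
    \<open>cinner\<close>.\<close>
  have inner: "inner (T u) (T v) = inner u v" if "u \<in> K" "v \<in> K" for u v
    using that K norm[of "u + v"] by (simp add: dot_norm lin norm complex_vector.subspace_add)
  have iy: "\<i> *\<^sub>C y \<in> K"
    using K xy by (simp add: complex_vector.subspace_scale)
  have "Re (cinner (T x) (\<i> *\<^sub>C T y)) = Re (cinner x (\<i> *\<^sub>C y))"
    using inner[OF xy(1) iy] lin xy by (simp add: inner_eq_Re_cinner)
  then show ?thesis
    using inner[OF xy] by (simp add: inner_eq_Re_cinner cinner_scaleC_right complex_eq_iff)
qed

lemma isometric_op_inj_on:
  assumes T: "isometric_op K L T" and K: "csubspace K"
  shows "inj_on T K"
proof (rule inj_onI)
  fix x y assume xy: "x \<in> K" "y \<in> K" "T x = T y"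
  then have d: "x - y \<in> K"
    using K complex_vector.subspace_diff by blast
  then have "T (x - y + y) = T (x - y) + T y"
    using T xy unfolding isometric_op_def bounded_op_def by blast
  then have "T (x - y) = 0"
    using xy by simp
  moreover have "norm (T (x - y)) = norm (x - y)"
    using T d by (simp add: isometric_op_def)
  ultimately show "x = y" by simp
qed

text \<open>The image of a complete space under a linear isometry is complete. This makes the
  projection onto the embedded copy of \<open>H\<close> meaningful.\<close>

lemma closed_csubspace_range_isometric:
  assumes "isometric_op UNIV K V"
  shows "closed_csubspace (range V)"
proof -
  have lin: "\<And>u v. V (u + v) = V u + V v" "\<And>c u. V (c *\<^sub>C u) = c *\<^sub>C V u"
    and norm: "\<And>u. norm (V u) = norm u"
    using assms by (auto simp: isometric_op_def bounded_op_def)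
  have "bounded_linear V"
    by (rule bounded_linear_intro[where K = 1]) (simp_all add: lin norm scaleR_scaleC)
  then have "complete (range V)"
    by (intro complete_isometric_image[of 1]) (simp_all add: norm complete_UNIV)
  moreover have "csubspace (range V)"
  proof (rule complex_vector.subspaceI; safe?)
    have "V 0 = 0"
      using norm[of 0] by simp
    then show "0 \<in> range V"
      by (metis rangeI)
  qed (simp_all flip: lin)
  ultimately show ?thesis
    by (simp add: closed_csubspace_def complete_eq_closed)
qed

text \<open>Complex polarisation: reality of the quadratic form at \<open>u\<close>,
  \<open>v\<close> and \<open>u + v\<close> forces the imaginary part of the symmetrised form to
  vanish. Taking \<open>v\<close> to be \<open>y\<close> gives the imaginary part of the symmetry
  relation, and \<open>\<i> *\<^sub>C y\<close> gives the real part.\<close>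

lemma positive_op_imp_selfadjoint_op:
  assumes T: "positive_op K T" and K: "csubspace K"
  shows "selfadjoint_op K T"
proof -
  have lin: "\<And>u v. u \<in> K \<Longrightarrow> v \<in> K \<Longrightarrow> T (u + v) = T u + T v"
    "\<And>c u. u \<in> K \<Longrightarrow> T (c *\<^sub>C u) = c *\<^sub>C T u"
    and real: "\<And>u. u \<in> K \<Longrightarrow> Im (cinner (T u) u) = 0"
    using T by (auto simp: positive_op_def bounded_op_def complex_is_Real_iff)
  have polar: "Im (cinner (T u) v + cinner (T v) u) = 0" if "u \<in> K" "v \<in> K" for u v
    using real[of "u + v"] real[of u] real[of v] that K
    by (simp add: lin cinner_add_left cinner_add_right complex_vector.subspace_add)
  have "cinner (T x) y = cinner x (T y)" if xy: "x \<in> K" "y \<in> K" for x y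
  proof -
    have "\<i> *\<^sub>C y \<in> K"
      using K xy by (simp add: complex_vector.subspace_scale)
    from polar[OF xy(1) this] have "Re (cinner (T x) y) = Re (cinner (T y) x)"
      by (simp add: lin xy cinner_scaleC_left cinner_scaleC_right)
    moreover have "Im (cinner (T x) y) = - Im (cinner (T y) x)"
      using polar[OF xy] by simp
    ultimately have "cinner (T x) y = cnj (cinner (T y) x)"
      by (simp add: complex_eq_iff)
    then show ?thesis
      by (metis cinner_commute)
  qed
  then show ?thesis
    using T by (simp add: selfadjoint_op_def positive_op_def)
qed

section \<open>Natural and integer powers\<close>

lemma funpow_mem: "B ` K \<subseteq> K \<Longrightarrow> x \<in> K \<Longrightarrow> (B ^^ n) x \<in> K"
  by (induction n) auto

text \<open>Factors of \<open>B\<close> move from right to left one at a time; each move raises the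
  left exponent, so the induction on \<open>m\<close> needs \<open>n\<close> arbitrary.\<close>

lemma selfadjoint_op_funpow:
  assumes B: "selfadjoint_op K B" and xy: "x \<in> K" "y \<in> K"
  shows "cinner ((B ^^ n) x) ((B ^^ m) y) = cinner ((B ^^ (n + m)) x) y"
proof (induction m arbitrary: n)
  case (Suc m)
  have K: "B ` K \<subseteq> K"
    using B by (simp add: selfadjoint_op_def bounded_op_def)
  have "cinner ((B ^^ n) x) (B ((B ^^ m) y)) = cinner (B ((B ^^ n) x)) ((B ^^ m) y)"
    using B funpow_mem[OF K xy(1)] funpow_mem[OF K xy(2)] by (simp add: selfadjoint_op_def)
  with Suc[of "Suc n"] show ?case by simp
qed simp

lemma isometric_op_funpow:
  assumes B: "isometric_op K K B" and K: "csubspace K" and xy: "x \<in> K" "y \<in> K"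
  shows "cinner ((B ^^ (k + n)) x) ((B ^^ n) y) = cinner ((B ^^ k) x) y"
proof (induction n)
  case (Suc n)
  have "B ` K \<subseteq> K"
    using B by (simp add: isometric_op_def bounded_op_def)
  with Suc show ?case
    using isometric_op_cinner[OF B K] xy by (simp add: funpow_mem)
qed simp

lemma int_power_mem:
  assumes "B ` K = K" "x \<in> K"
  shows "int_power K B n x \<in> K"
proof -
  have "inv_into K B ` K \<subseteq> K"
    using assms(1) by (auto intro: inv_into_into)
  then show ?thesis
    using assms by (simp add: int_power_def funpow_mem)
qed

lemma int_power_add_one:
  assumes B: "B ` K = K" and x: "x \<in> K"
  shows "int_power K B (n + 1) x = B (int_power K B n x)"
proof (cases "0 \<le> n")
  case True
  then have "nat (n + 1) = Suc (nat n)"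
    by simp
  with True show ?thesis
    by (simp add: int_power_def)
next
  case False
  \<comment> \<open>Writing the negative exponent as \<open>-(k + 1)\<close> exposes one inverse
    factor, which \<open>B\<close> cancels. The later split on \<open>k\<close> is needed because
    for \<open>k = 0\<close> the exponent \<open>n + 1\<close> is 0 and falls under the nonnegative
    branch of \<open>int_power\<close>.\<close>
  define k where "k = nat (- n) - 1"
  have n: "n = - int (Suc k)"
    using False by (simp add: k_def)
  have "(inv_into K B ^^ k) x \<in> K"
    by (rule funpow_mem[OF _ x]) (use B in \<open>auto intro: inv_into_into\<close>)
  then have "B (inv_into K B ((inv_into K B ^^ k) x)) = (inv_into K B ^^ k) x"
    using B by (simp add: f_inv_into_f)
  moreover have "int_power K B (n + 1) x = (inv_into K B ^^ k) x"
    by (cases k) (simp_all add: int_power_def n nat_add_distrib)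
  moreover have "int_power K B n x = inv_into K B ((inv_into K B ^^ k) x)"
    by (simp add: int_power_def n nat_add_distrib)
  ultimately show ?thesis
    by simp
qed

lemma unitary_op_int_power:
  assumes B: "unitary_op K K B" and K: "csubspace K" and xy: "x \<in> K" "y \<in> K"
  shows "cinner (int_power K B (n + int k) x) (int_power K B (m + int k) y)
    = cinner (int_power K B n x) (int_power K B m y)"
proof (induction k)
  case (Suc k)
  have iso: "isometric_op K K B" and im: "B ` K = K"
    using B by (auto simp: unitary_op_def)
  have "cinner (int_power K B (n + int k + 1) x) (int_power K B (m + int k + 1) y)
    = cinner (int_power K B (n + int k) x) (int_power K B (m + int k) y)"
    using xy im by (simp add: int_power_add_one isometric_op_cinner[OF iso K] int_power_mem)
  with Suc show ?case
    by (simp add: ac_simps)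
qed simp

lemma bounded_op_restrict:
  assumes T: "bounded_op K L T" and "K' \<subseteq> K" "T ` K' \<subseteq> L'"
  shows "bounded_op K' L' T"
proof -
  obtain C where "\<And>x. x \<in> K \<Longrightarrow> norm (T x) \<le> C * norm x"
    using T unfolding bounded_op_def by blast
  with assms show ?thesis
    unfolding bounded_op_def by (intro conjI exI[of _ C]) (simp_all add: subset_iff)
qed

text \<open>The invariance argument for closed spans is to be applied to the inverse of a unitary as
  well. Linearity comes from injectivity: both sides are the preimage of the same vector.\<close>

lemma bounded_op_inv_into:
  assumes T: "unitary_op K L T" and K: "csubspace K"
  shows "bounded_op L K (inv_into K T)"
proof -
  have iso: "isometric_op K L T" and im: "T ` K = L"
    using T by (auto simp: unitary_op_def)
  have lin: "\<And>u v. u \<in> K \<Longrightarrow> v \<in> K \<Longrightarrow> T (u + v) = T u + T v"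
    "\<And>c u. u \<in> K \<Longrightarrow> T (c *\<^sub>C u) = c *\<^sub>C T u"
    and norm: "\<And>u. u \<in> K \<Longrightarrow> norm (T u) = norm u"
    using iso by (auto simp: isometric_op_def bounded_op_def)
  note inj = isometric_op_inj_on[OF iso K]
  have in_K: "inv_into K T x \<in> K" and T_inv: "T (inv_into K T x) = x" if "x \<in> L" for x
    using that im by (auto intro: inv_into_into f_inv_into_f)
  show ?thesis
    unfolding bounded_op_def
  proof (intro conjI exI[of _ 1] ballI allI)
    show "inv_into K T ` L \<subseteq> K"
      using in_K by blast
    show "norm (inv_into K T x) \<le> 1 * norm x" if "x \<in> L" for x
      using norm[OF in_K[OF that]] T_inv[OF that] by simp
    show "inv_into K T (x + y) = inv_into K T x + inv_into K T y" if "x \<in> L" "y \<in> L" for x y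
      by (rule inv_into_f_eq[OF inj])
        (use that K in \<open>simp_all add: in_K T_inv lin complex_vector.subspace_add\<close>)
    show "inv_into K T (c *\<^sub>C x) = c *\<^sub>C inv_into K T x" if "x \<in> L" for c x
      by (rule inv_into_f_eq[OF inj])
        (use that K in \<open>simp_all add: in_K T_inv lin complex_vector.subspace_scale\<close>)
  qed
qed

section \<open>Gram families of dilations\<close>

lemma dilation_embedding_mem: "dilation A K V B \<Longrightarrow> V h \<in> K"
  by (auto simp: dilation_def isometric_op_def bounded_op_def)

text \<open>The projection is invisible against a vector of \<open>range V\<close>, and
  \<open>V\<close> preserves inner products.\<close>

lemma dilation_moment:
  assumes "dilation A K V B"
  shows "cinner ((B ^^ n) (V h)) (V g) = cinner (A n h) g"
proof -
  have V: "isometric_op UNIV K V" and A: "V (A n h) = orth_proj (range V) ((B ^^ n) (V h))"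
    using assms by (auto simp: dilation_def)
  have "cinner (A n h) g = cinner (V (A n h)) (V g)"
    using isometric_op_cinner[OF V] by simp
  also have "\<dots> = cinner ((B ^^ n) (V h)) (V g)"
    unfolding A by (rule cinner_orth_proj[OF closed_csubspace_range_isometric[OF V]]) simp
  finally show ?thesis ..
qed

lemma selfadjoint_dilation_gram:
  assumes "dilation A K V B" "selfadjoint_op K B"
  shows "cinner ((B ^^ n) (V h)) ((B ^^ m) (V g)) = cinner (A (n + m) h) g"
  using assms by (simp add: selfadjoint_op_funpow dilation_embedding_mem dilation_moment)

text \<open>An isometry cancels the common powers, so only the difference of exponents matters. As
  \<open>A\<close> has natural indices, the case \<open>n < m\<close> is read off by conjugate
  symmetry.\<close>

lemma isometric_dilation_gram:
  assumes D: "dilation A K V B" and B: "isometric_op K K B"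
  shows "cinner ((B ^^ n) (V h)) ((B ^^ m) (V g)) =
    (if m \<le> n then cinner (A (n - m) h) g else cnj (cinner (A (m - n) g) h))"
proof -
  have K: "csubspace K"
    using D by (simp add: dilation_def closed_csubspace_def)
  have *: "cinner ((B ^^ (k + n)) (V h)) ((B ^^ n) (V g)) = cinner (A k h) g" for k n h g
    using isometric_op_funpow[OF B K] D by (simp add: dilation_embedding_mem dilation_moment)
  show ?thesis
  proof (cases "m \<le> n")
    case True
    with *[of "n - m" m h g] show ?thesis by simp
  next
    case False
    with *[of "m - n" n g h] show ?thesis
      by (subst cinner_commute) simp
  qed
qed

lemma unitary_dilation_gram:
  assumes D: "dilation A K V B" and B: "unitary_op K K B"
  shows "cinner (int_power K B n (V h)) (int_power K B m (V g)) =
    (if m \<le> n then cinner (A (nat (n - m)) h) g else cnj (cinner (A (nat (m - n)) g) h))"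
proof -
  have K: "csubspace K"
    using D by (simp add: dilation_def closed_csubspace_def)
  have *: "cinner (int_power K B n (V h)) (int_power K B m (V g)) = cinner (A (nat (n - m)) h) g"
    if "m \<le> n" for m n h g
  proof -
    have shift: "cinner (int_power K B (n' + int k) (V h)) (int_power K B (m' + int k) (V g))
        = cinner (int_power K B n' (V h)) (int_power K B m' (V g))" for n' m' k
      using unitary_op_int_power[OF B K] D by (simp add: dilation_embedding_mem)
    \<comment> \<open>The simultaneous shift brings the right exponent to 0: for
      \<open>0 \<le> m\<close> the pair \<open>(n, m)\<close> is \<open>(n - m, 0)\<close> shifted
      up by \<open>m\<close>, otherwise \<open>(n, m)\<close> itself is shifted up by
      \<open>- m\<close>.\<close>
    have "cinner (int_power K B n (V h)) (int_power K B m (V g))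
        = cinner (int_power K B (n - m) (V h)) (int_power K B 0 (V g))"
    proof (cases "0 \<le> m")
      case True
      then show ?thesis
        using shift[of "n - m" "nat m" 0] by simp
    next
      case False
      then show ?thesis
        using shift[of n "nat (- m)" m] by simp
    qed
    also have "\<dots> = cinner (A (nat (n - m)) h) g"
      using that D by (simp add: int_power_def dilation_moment)
    finally show ?thesis .
  qed
  show ?thesis
    using *[of m n h g] *[of n m g h]
    by (cases "m \<le> n") (simp, subst cinner_commute, simp)
qed

section \<open>Uniqueness of minimal dilations\<close>

lemma minimal_dilation_unique:
  assumes D1: "minimal_dilation p A K1 V1 B1" and D2: "minimal_dilation p A K2 V2 B2"
  shows "unitarily_equivalent K1 V1 B1 K2 V2 B2"
proof -
  have d: "dilation A K1 V1 B1" "dilation A K2 V2 B2"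
    and kind: "has_kind p K1 B1" "has_kind p K2 B2"
    using D1 D2 by (auto simp: minimal_dilation_def dilation_of_kind_def)
  have K: "csubspace K1" "csubspace K2" and B: "bounded_op K1 K1 B1" "bounded_op K2 K2 B2"
    using d by (auto simp: dilation_def closed_csubspace_def)
  show ?thesis
  proof (cases "p = Unitary")
    case True
    have u: "unitary_op K1 K1 B1" "unitary_op K2 K2 B2"
      using kind True by auto
    then have im: "B1 ` K1 = K1" "B2 ` K2 = K2"
      by (auto simp: unitary_op_def)
    \<comment> \<open>The orbit is indexed by pairs \<open>(n, h)\<close>. Both operators act on it
      by \<open>n \<mapsto> n + 1\<close>, and the exponent 0 gives the embedded vectors, which
      makes \<open>W\<close> fix \<open>H\<close>.\<close>
    define e where "e = (\<lambda>(n, h). int_power K1 B1 n (V1 h))"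
    define f where "f = (\<lambda>(n, h). int_power K2 B2 n (V2 h))"
    obtain W where W: "unitary_op K1 K2 W" "\<And>x. x \<in> K1 \<Longrightarrow> W (B1 x) = B2 (W x)"
      "\<And>i. W (e i) = f i"
    proof (rule unitary_intertwiner[where e = e and f = f and \<sigma> = "\<lambda>(n, h). (n + 1, h)"])
      show "cinner (e i) (e j) = cinner (f i) (f j)" for i j
        by (cases i; cases j)
          (simp add: e_def f_def unitary_dilation_gram[OF d(1) u(1)]
            unitary_dilation_gram[OF d(2) u(2)])
      have "range e = {int_power K1 B1 n (V1 h) | n h. True}"
        "range f = {int_power K2 B2 n (V2 h) | n h. True}"
        by (auto simp: e_def f_def)
      then show "K1 = closure (cspan (range e))" "K2 = closure (cspan (range f))"
        using D1 D2 True by (simp_all add: minimal_dilation_def)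
      show "B1 (e i) = e (case i of (n, h) \<Rightarrow> (n + 1, h))"
        "B2 (f i) = f (case i of (n, h) \<Rightarrow> (n + 1, h))" for i
        by (cases i; simp add: e_def f_def int_power_add_one im dilation_embedding_mem[OF d(1)]
            dilation_embedding_mem[OF d(2)])+
      show "bounded_op K1 K1 B1" "bounded_op K2 K2 B2"
        by (rule B)+
    qed (rule that)
    have "W (V1 h) = V2 h" for h
      using W(3)[of "(0, h)"] by (simp add: e_def f_def int_power_def)
    with W show ?thesis
      unfolding unitarily_equivalent_def by blast
  next
    case False
    define e where "e = (\<lambda>(n, h). (B1 ^^ n) (V1 h))"
    define f where "f = (\<lambda>(n, h). (B2 ^^ n) (V2 h))"
    \<comment> \<open>In each remaining case the right-hand side of the Gram formula involves
      \<open>A\<close> alone, so the two orbits agree; the positive case is subsumed under the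
      self-adjoint one.\<close>
    have gram: "cinner ((B1 ^^ n) (V1 h)) ((B1 ^^ m) (V1 g))
        = cinner ((B2 ^^ n) (V2 h)) ((B2 ^^ m) (V2 g))" for n m h g
    proof (cases "p = Isometric")
      case True
      with kind show ?thesis
        by (simp add: isometric_dilation_gram[OF d(1)] isometric_dilation_gram[OF d(2)])
    next
      case non_iso: False
      have "selfadjoint_op K1 B1" "selfadjoint_op K2 B2"
        using kind False non_iso K positive_op_imp_selfadjoint_op by (cases p; auto)+
      then show ?thesis
        by (simp add: selfadjoint_dilation_gram[OF d(1)] selfadjoint_dilation_gram[OF d(2)])
    qed
    obtain W where W: "unitary_op K1 K2 W" "\<And>x. x \<in> K1 \<Longrightarrow> W (B1 x) = B2 (W x)"
      "\<And>i. W (e i) = f i"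
    proof (rule unitary_intertwiner[where e = e and f = f and \<sigma> = "\<lambda>(n, h). (Suc n, h)"])
      show "cinner (e i) (e j) = cinner (f i) (f j)" for i j
        by (cases i; cases j) (simp add: e_def f_def gram)
      have "range e = {(B1 ^^ n) (V1 h) | n h. True}" "range f = {(B2 ^^ n) (V2 h) | n h. True}"
        by (auto simp: e_def f_def)
      then show "K1 = closure (cspan (range e))" "K2 = closure (cspan (range f))"
        using D1 D2 False by (simp_all add: minimal_dilation_def)
      show "B1 (e i) = e (case i of (n, h) \<Rightarrow> (Suc n, h))"
        "B2 (f i) = f (case i of (n, h) \<Rightarrow> (Suc n, h))" for i
        by (cases i; simp add: e_def f_def)+
      show "bounded_op K1 K1 B1" "bounded_op K2 K2 B2"
        by (rule B)+
    qed (rule that)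
    have "W (V1 h) = V2 h" for h
      using W(3)[of "(0, h)"] by (simp add: e_def f_def)
    with W show ?thesis
      unfolding unitarily_equivalent_def by blast
  qed
qed

section \<open>Existence of minimal dilations\<close>

lemma dilation_restrict:
  assumes D: "dilation A K V B" and K': "closed_csubspace K'" "K' \<subseteq> K" "range V \<subseteq> K'" "B ` K' \<subseteq> K'"
  shows "dilation A K' V B"
proof -
  have "isometric_op UNIV K' V"
    using D K' bounded_op_restrict[of UNIV K V UNIV K'] by (simp add: dilation_def isometric_op_def)
  moreover have "bounded_op K' K' B"
    using D K' bounded_op_restrict[of K K B K' K'] by (simp add: dilation_def)
  ultimately show ?thesis
    using D K' by (simp add: dilation_def)
qed

lemma minimal_dilation_exists_nat:
  assumes D: "dilation_of_kind p A K V B" and p: "p \<noteq> Unitary"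
  shows "\<exists>K'. minimal_dilation p A K' V B"
proof -
  define S where "S = {(B ^^ n) (V h) | n h. True}"
  define K' where "K' = closure (cspan S)"
  have d: "dilation A K V B" and kind: "has_kind p K B"
    using D by (auto simp: dilation_of_kind_def)
  have K: "closed_csubspace K" and B: "bounded_op K K B"
    using d by (auto simp: dilation_def)
  have c: "closed_csubspace K'"
    unfolding K'_def by (rule closed_csubspace_closure_cspan)
  have SK': "S \<subseteq> K'"
    unfolding K'_def by (rule closure_cspan_superset)
  have "B ` K \<subseteq> K"
    using B by (simp add: bounded_op_def)
  then have SK: "S \<subseteq> K"
    using d by (auto simp: S_def funpow_mem dilation_embedding_mem)
  have sub: "K' \<subseteq> K"
    unfolding K'_def using K SK by (rule closure_cspan_minimal)
  have "B x \<in> S" if "x \<in> S" for x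
    using that unfolding S_def by clarify (metis funpow.simps(2) comp_apply)
  then have BK': "B ` K' \<subseteq> K'"
    using bounded_op_maps_closure_cspan[OF B K SK _ c] SK' unfolding K'_def by blast
  have "V h \<in> S" for h
    unfolding S_def by clarify (metis funpow_0)
  then have "dilation A K' V B"
    using SK' by (intro dilation_restrict[OF d c sub _ BK']) blast
  \<comment> \<open>Apart from boundedness, these three properties are conditions on the vectors of
    the space, so they pass to an invariant subspace.\<close>
  moreover have "has_kind p K' B"
    using kind p sub bounded_op_restrict[OF B sub BK']
    by (cases p) (auto simp: selfadjoint_op_def positive_op_def isometric_op_def)
  ultimately show ?thesis
    using p by (auto simp: minimal_dilation_def dilation_of_kind_def K'_def S_def)
qed

text \<open>Invariance under \<open>B\<close> alone would leave an isometry; surjectivity on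
  \<open>K'\<close> requires invariance under the inverse too, which is why the orbit runs over all
  integers.\<close>

lemma minimal_dilation_exists_unitary:
  assumes D: "dilation_of_kind Unitary A K V B"
  shows "\<exists>K'. minimal_dilation Unitary A K' V B"
proof -
  define S where "S = {int_power K B n (V h) | n h. True}"
  define K' where "K' = closure (cspan S)"
  have d: "dilation A K V B" and u: "unitary_op K K B"
    using D by (auto simp: dilation_of_kind_def)
  have K: "closed_csubspace K" "csubspace K" and B: "bounded_op K K B"
    using d by (auto simp: dilation_def closed_csubspace_def)
  have iso: "isometric_op K K B" and im: "B ` K = K"
    using u by (auto simp: unitary_op_def)
  have inj: "inj_on B K"
    using isometric_op_inj_on[OF iso K(2)] .
  note VK = dilation_embedding_mem[OF d]
  have c: "closed_csubspace K'"
    unfolding K'_def by (rule closed_csubspace_closure_cspan)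
  have SK': "S \<subseteq> K'"
    unfolding K'_def by (rule closure_cspan_superset)
  have SK: "S \<subseteq> K"
    using im VK by (auto simp: S_def int_power_mem)
  have sub: "K' \<subseteq> K"
    unfolding K'_def using K(1) SK by (rule closure_cspan_minimal)
  have "B x \<in> S" if "x \<in> S" for x
    using that unfolding S_def by clarify (metis int_power_add_one[OF im VK])
  then have BK': "B ` K' \<subseteq> K'"
    using bounded_op_maps_closure_cspan[OF B K(1) SK _ c] SK' unfolding K'_def by blast
  \<comment> \<open>The inverse lowers the exponent of an orbit vector by one and so stays in the
    orbit.\<close>
  have "inv_into K B x \<in> S" if "x \<in> S" for x
  proof -
    obtain n h where x: "x = int_power K B n (V h)"
      using \<open>x \<in> S\<close> by (auto simp: S_def)
    have "x = B (int_power K B (n - 1) (V h))"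
      using int_power_add_one[OF im VK, of "n - 1"] by (simp add: x)
    then have "inv_into K B x = int_power K B (n - 1) (V h)"
      using inj int_power_mem[OF im VK] by simp
    then show ?thesis
      by (auto simp: S_def)
  qed
  then have invK': "inv_into K B ` K' \<subseteq> K'"
    using bounded_op_maps_closure_cspan[OF bounded_op_inv_into[OF u K(2)] K(1) SK _ c] SK'
    unfolding K'_def by blast
  have B_inv: "B (inv_into K B x) = x" if "x \<in> K'" for x
    using that sub im by (intro f_inv_into_f) blast
  have im': "B ` K' = K'"
  proof
    show "K' \<subseteq> B ` K'"
    proof
      fix x assume x: "x \<in> K'"
      then have "B (inv_into K B x) = x" "inv_into K B x \<in> K'"
        using B_inv invK' by blast+
      then show "x \<in> B ` K'"
        by (metis imageI)
    qed
  qed (rule BK')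
  \<comment> \<open>\<open>inv_into\<close> depends on its domain. The inverse taken in
    \<open>K\<close> already lands in \<open>K'\<close>, and injectivity identifies it with the
    inverse taken in \<open>K'\<close>.\<close>
  have inv_eq: "inv_into K' B x = inv_into K B x" if "x \<in> K'" for x
    using that invK' B_inv by (intro inv_into_f_eq inj_on_subset[OF inj sub]) auto
  have VS: "V h \<in> S" for h
  proof -
    have "V h = int_power K B 0 (V h)"
      by (simp add: int_power_def)
    then show ?thesis
      unfolding S_def by blast
  qed
  \<comment> \<open>Minimality of the restriction refers to powers formed in \<open>K'\<close>,
    whereas \<open>S\<close> was built from powers formed in \<open>K\<close>.\<close>
  have pow_eq: "int_power K' B n (V h) = int_power K B n (V h)" for n h
  proof -
    have "(inv_into K' B ^^ k) (V h) = (inv_into K B ^^ k) (V h)" for k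
    proof (induction k)
      case (Suc k)
      have "(inv_into K B ^^ k) (V h) \<in> K'"
        using VS SK' by (intro funpow_mem[OF invK']) blast
      with Suc show ?case by (simp add: inv_eq)
    qed simp
    then show ?thesis
      by (simp add: int_power_def)
  qed
  have "dilation A K' V B"
    using VS SK' by (intro dilation_restrict[OF d c sub _ BK']) blast
  moreover have "unitary_op K' K' B"
    using iso sub im' bounded_op_restrict[OF B sub BK']
    by (auto simp: unitary_op_def isometric_op_def)
  moreover have "K' = closure (cspan {int_power K' B n (V h) | n h. True})"
    unfolding pow_eq by (simp add: K'_def S_def)
  ultimately have "minimal_dilation Unitary A K' V B"
    by (simp add: minimal_dilation_def dilation_of_kind_def)
  then show ?thesis ..
qed

theorem theorem1p3:
  fixes p :: dilation_kind
    and A :: "nat \<Rightarrow> 'h::chilbert_space \<Rightarrow> 'h"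
    and K :: "'k::chilbert_space set"
    and V :: "'h \<Rightarrow> 'k"
    and B :: "'k \<Rightarrow> 'k"
  assumes "\<And>n. bounded_op UNIV UNIV (A n)"
    and "A 0 = id"
    and "dilation_of_kind p A K V B"
  shows "(\<exists>(K' :: 'k set) V' B'. minimal_dilation p A K' V' B') \<and>
    (\<forall>(K1 :: 'k1::chilbert_space set) V1 B1 (K2 :: 'k2::chilbert_space set) V2 B2.
       minimal_dilation p A K1 V1 B1 \<longrightarrow> minimal_dilation p A K2 V2 B2 \<longrightarrow>
       unitarily_equivalent K1 V1 B1 K2 V2 B2)"
proof (intro conjI allI impI)
  show "\<exists>(K' :: 'k set) V' B'. minimal_dilation p A K' V' B'"
    using assms(3) minimal_dilation_exists_nat minimal_dilation_exists_unitary by metis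
qed (rule minimal_dilation_unique)

end
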